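(* Let $B=B(F)$ be a generalized stationary 0-1 Bratteli diagram with vertex set $V_0$ and edge set $E$, let $q=(q_v : v\in V_0)$ be a positive probability vector, let $P$ be a Markov matrix for $B$, and let $m=m(P)$ be the corresponding stationary Markov measure on the path space $X_B$, i.e. $$m([e_0,e_1,\ldots,e_n])=q_{s(e_0)}\,p_{s(e_0),r(e_0)}\cdots p_{s(e_n),r(e_n)}.$$ Then $m$ is $\sigma$-invariant (i.e. $m\circ\sigma^{-1}=m$ for the shift $\sigma(x_0,x_1,x_2,\ldots)=(x_1,x_2,\ldots)$) if and only if $qP=q$.
   Context: A generalized stationary Bratteli diagram $B=B(F)$ is defined as follows. Let $V_0$ be a countably infinite set (identified with $\mathbb N$ or $\mathbb Z$), and let $F=(f_{v,w})_{v,w\in V_0}$ be an infinite matrix with entries in $\mathbb N_0=\{0,1,2,\ldots\}$ such that every row has only finitely many non-zero entries and every row and every column has at least one non-zero entry. The vertex set is $\mathcal V=\bigsqcup_{i\ge 0}V_i$ with $V_i=V_0$ for all $i$. Between level $V_i$ and level $V_{i+1}$ there are exactly $f_{v,w}$ edges from $w\in V_i$ to $v\in V_{i+1}$. The set of edges between consecutive levels does not depend on the level and is denoted $E$. For an edge $e$ from $w$ to $v$, $s(e)=w$ is its source and $r(e)=v$ its range. The diagram is a 0-1 diagram if all entries of $F$ are $0$ or $1$; then an edge $e$ is identified with the pair $(s(e),r(e))$. The path space $X_B$ is the set of all infinite sequences $x=(x_i)_{i\ge0}$ of edges with $r(x_i)=s(x_{i+1})$ for all $i\geq 0$. For a finite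 path $\overline e=(e_0,\ldots,e_n)$ the cylinder set is $[\overline e]=\{x\in X_B : x_0=e_0,\ldots,x_n=e_n\}$; cylinder sets form a base of a Polish zero-dimensional topology on $X_B$. Standing assumptions of the paper: $X_B$ has no isolated points, and the tail equivalence relation ($x\sim y$ iff $x_i=y_i$ for all sufficiently large $i$) has no finite classes. A Markov matrix for $B$ is a matrix $P=(p_{w,v})_{w,v\in V_0}$ with non-negative entries such that $p_{w,v}>0$ if and only if there is an edge from $w$ to $v$, and $\sum_{v}p_{w,v}=1$ for every $w\in V_0$. The condition $qP=q$ means $\sum_{w}q_wp_{w,v}=q_v$ for all $v\in V_0$. *)

theory Defs
  imports "HOL-Analysis.Analysis"
begin

text \<open>The vertex set \<open>V\<^sub>0\<close> is the type \<open>'v\<close>, required to be countably infinite.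
  The entry \<open>F v w\<close> is the number of edges from \<open>w\<close> (at level \<open>i\<close>) to \<open>v\<close> (at level \<open>i + 1\<close>),
  so rows of \<open>F\<close> are indexed by ranges and columns by sources.\<close>

definition is_incidence_matrix :: "('v \<Rightarrow> 'v \<Rightarrow> nat) \<Rightarrow> bool" where
  "is_incidence_matrix F \<longleftrightarrow>
     countable (UNIV :: 'v set) \<and> infinite (UNIV :: 'v set) \<and>
     (\<forall>v. finite {w. F v w \<noteq> 0}) \<and>
     (\<forall>v. \<exists>w. F v w \<noteq> 0) \<and>
     (\<forall>w. \<exists>v. F v w \<noteq> 0)"

definition zero_one :: "('v \<Rightarrow> 'v \<Rightarrow> nat) \<Rightarrow> bool" where
  "zero_one F \<longleftrightarrow> (\<forall>v w. F v w \<in> {0, 1})"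

text \<open>An edge is a triple (source, range, label), where the labels \<open>0, \<dots>, F v w - 1\<close> distinguish
  parallel edges from \<open>w\<close> to \<open>v\<close>. For a 0-1 diagram the label is always \<open>0\<close>, so that edges are
  just pairs (source, range). As the edge set between consecutive levels is the same for all
  levels, the level of an edge in a path is its position in the sequence.\<close>

type_synonym 'v edge = "'v \<times> 'v \<times> nat"

definition src :: "'v edge \<Rightarrow> 'v" where "src e = fst e"

definition rng :: "'v edge \<Rightarrow> 'v" where "rng e = fst (snd e)"

definition edges :: "('v \<Rightarrow> 'v \<Rightarrow> nat) \<Rightarrow> 'v edge set" where
  "edges F = {(w, v, k) | w v k. k < F v w}"

definition path_space :: "('v \<Rightarrow> 'v \<Rightarrow> nat) \<Rightarrow> (nat \<Rightarrow> 'v edge) set" where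
  "path_space F = {x. \<forall>i. x i \<in> edges F \<and> rng (x i) = src (x (Suc i))}"

definition finite_paths :: "('v \<Rightarrow> 'v \<Rightarrow> nat) \<Rightarrow> 'v edge list set" where
  "finite_paths F = {es. es \<noteq> [] \<and> set es \<subseteq> edges F \<and>
     (\<forall>i. Suc i < length es \<longrightarrow> rng (es ! i) = src (es ! Suc i))}"

definition cylinder :: "('v \<Rightarrow> 'v \<Rightarrow> nat) \<Rightarrow> 'v edge list \<Rightarrow> (nat \<Rightarrow> 'v edge) set" where
  "cylinder F es = {x \<in> path_space F. \<forall>i < length es. x i = es ! i}"

text \<open>Two cylinder sets are either nested or disjoint, so the cylinder sets are a base of the
  topology they generate.\<close>

definition path_topology :: "('v \<Rightarrow> 'v \<Rightarrow> nat) \<Rightarrow> (nat \<Rightarrow> 'v edge) topology" where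
  "path_topology F = topology_generated_by (cylinder F ` finite_paths F)"

definition path_borel :: "('v \<Rightarrow> 'v \<Rightarrow> nat) \<Rightarrow> (nat \<Rightarrow> 'v edge) measure" where
  "path_borel F = sigma (path_space F) {U. openin (path_topology F) U}"

definition no_isolated_points :: "('v \<Rightarrow> 'v \<Rightarrow> nat) \<Rightarrow> bool" where
  "no_isolated_points F \<longleftrightarrow> (\<forall>x \<in> path_space F. \<not> openin (path_topology F) {x})"

definition tail_equivalent :: "(nat \<Rightarrow> 'v edge) \<Rightarrow> (nat \<Rightarrow> 'v edge) \<Rightarrow> bool" where
  "tail_equivalent x y \<longleftrightarrow> (\<forall>\<^sub>F i in sequentially. x i = y i)"

definition no_finite_tail_classes :: "('v \<Rightarrow> 'v \<Rightarrow> nat) \<Rightarrow> bool" where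
  "no_finite_tail_classes F \<longleftrightarrow>
     (\<forall>x \<in> path_space F. infinite {y \<in> path_space F. tail_equivalent x y})"

definition positive_probability_vector :: "('v \<Rightarrow> real) \<Rightarrow> bool" where
  "positive_probability_vector q \<longleftrightarrow> (\<forall>v. q v > 0) \<and> (q has_sum 1) UNIV"

text \<open>In contrast to \<open>F\<close>, the first index of a Markov matrix is the source. Its rows may have
  infinitely many non-zero entries.\<close>

definition markov_matrix :: "('v \<Rightarrow> 'v \<Rightarrow> nat) \<Rightarrow> ('v \<Rightarrow> 'v \<Rightarrow> real) \<Rightarrow> bool" where
  "markov_matrix F P \<longleftrightarrow>
     (\<forall>w v. P w v \<ge> 0) \<and>
     (\<forall>w v. P w v > 0 \<longleftrightarrow> (\<exists>e \<in> edges F. src e = w \<and> rng e = v)) \<and>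
     (\<forall>w. (P w has_sum 1) UNIV)"

definition stationary_markov_measure ::
  "('v \<Rightarrow> 'v \<Rightarrow> nat) \<Rightarrow> ('v \<Rightarrow> real) \<Rightarrow> ('v \<Rightarrow> 'v \<Rightarrow> real) \<Rightarrow> (nat \<Rightarrow> 'v edge) measure \<Rightarrow> bool" where
  "stationary_markov_measure F q P m \<longleftrightarrow>
     space m = path_space F \<and> sets m = sets (path_borel F) \<and>
     (\<forall>es \<in> finite_paths F. emeasure m (cylinder F es) =
        ennreal (q (src (es ! 0)) * (\<Prod>i<length es. P (src (es ! i)) (rng (es ! i)))))"

definition shift :: "(nat \<Rightarrow> 'e) \<Rightarrow> (nat \<Rightarrow> 'e)" where
  "shift x = (\<lambda>i. x (Suc i))"

definition shift_invariant :: "(nat \<Rightarrow> 'e) measure \<Rightarrow> bool" where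
  "shift_invariant m \<longleftrightarrow> (\<forall>A \<in> sets m. emeasure m (shift -` A \<inter> space m) = emeasure m A)"

end

theory Submission
  imports Defs
begin

text \<open>The cylinder sets form a countable intersection-stable generator of the Borel sets, so
  invariance only has to be checked on them. The preimage of \<open>[e\<^sub>0, \<dots>, e\<^sub>n]\<close> under the shift is the
  disjoint union of the cylinders \<open>[e, e\<^sub>0, \<dots>, e\<^sub>n]\<close> over the edges \<open>e\<close> ending in \<open>v = s(e\<^sub>0)\<close>, which
  are finitely many because the rows of the incidence matrix are finite. Its measure is therefore that
  of \<open>[e\<^sub>0, \<dots>, e\<^sub>n]\<close> with the factor \<open>q\<^sub>v\<close> replaced by \<open>(qP)\<^sub>v\<close>, and the remaining factor is
  positive.\<close>

section \<open>Cylinder sets as a countable generator of the Borel sets\<close>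

lemma countable_finite_paths:
  fixes F :: "'v \<Rightarrow> 'v \<Rightarrow> nat"
  assumes "countable (UNIV :: 'v set)"
  shows "countable (finite_paths F)"
proof -
  have "countable (UNIV \<times> UNIV \<times> UNIV :: 'v edge set)"
    by (intro countable_SIGMA assms countableI_type)
  then have "countable (lists (UNIV :: 'v edge set))"
    unfolding UNIV_Times_UNIV by (rule countable_lists)
  then show ?thesis
    by (rule countable_subset[rotated]) auto
qed

text \<open>A common path forces \<open>es\<close> and \<open>fs\<close> to agree at all positions
  of the shorter word \<open>es\<close>. Then \<open>es\<close> is a prefix of \<open>fs\<close>,
  and every path through \<open>fs\<close> passes through \<open>es\<close>.\<close>

lemma cylinder_Int:
  assumes "length es \<le> length fs"
  shows "cylinder F es \<inter> cylinder F fs = {} \<or> cylinder F es \<inter> cylinder F fs = cylinder F fs"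
  using assms unfolding cylinder_def by fastforce

text \<open>Any two words are comparable in length, so the nested-or-disjoint dichotomy always
  applies. The empty set is added to account for disjoint cylinders.\<close>

lemma Int_stable_cylinders: "Int_stable (insert {} (cylinder F ` finite_paths F))"
proof -
  have "cylinder F es \<inter> cylinder F fs \<in> insert {} (cylinder F ` finite_paths F)"
    if "es \<in> finite_paths F" "fs \<in> finite_paths F" for es fs
    using that cylinder_Int[of es fs F] cylinder_Int[of fs es F] linear[of "length es" "length fs"]
    by (auto simp: Int_commute)
  then show ?thesis
    unfolding Int_stable_def by blast
qed

lemma singleton_finite_path: "e \<in> edges F \<Longrightarrow> [e] \<in> finite_paths F"
  by (simp add: finite_paths_def)

lemma path_space_eq_Union_cylinders: "path_space F = \<Union> (cylinder F ` finite_paths F)"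
proof (intro equalityI subsetI)
  fix x assume x: "x \<in> path_space F"
  then have "x \<in> cylinder F [x 0]" "[x 0] \<in> finite_paths F"
    by (auto simp: cylinder_def path_space_def intro: singleton_finite_path)
  then show "x \<in> \<Union> (cylinder F ` finite_paths F)"
    by blast
qed (auto simp: cylinder_def)

text \<open>The topology is defined with the cylinders as a subbase; here they turn out to be a
  base. In the intersection step, two cylinders through \<open>x\<close> meet in a set that is empty
  or a cylinder, and \<open>x\<close> excludes the former.\<close>

lemma path_topology_base:
  assumes "openin (path_topology F) U" and "x \<in> U"
  shows "\<exists>es \<in> finite_paths F. x \<in> cylinder F es \<and> cylinder F es \<subseteq> U"
proof -
  have "generate_topology_on (cylinder F ` finite_paths F) U"
    using assms(1) by (simp add: path_topology_def openin_topology_generated_by_iff)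
  then show ?thesis
    using assms(2)
  proof (induction arbitrary: x)
    case (Int a b)
    obtain es where es: "es \<in> finite_paths F" "x \<in> cylinder F es" "cylinder F es \<subseteq> a"
      using Int by blast
    obtain fs where fs: "fs \<in> finite_paths F" "x \<in> cylinder F fs" "cylinder F fs \<subseteq> b"
      using Int by blast
    have "cylinder F es \<inter> cylinder F fs \<in> insert {} (cylinder F ` finite_paths F)"
      using Int_stable_cylinders es(1) fs(1) unfolding Int_stable_def by blast
    then obtain gs where "gs \<in> finite_paths F" "cylinder F gs = cylinder F es \<inter> cylinder F fs"
      using es(2) fs(2) by auto
    then show ?case
      using es fs by blast
  next
    case (UN K)
    then obtain k where "k \<in> K" "x \<in> k" by blast
    then show ?case
      using UN.IH by blast
  qed auto
qed

text \<open>Since there are only countably many cylinders, every open set is a countable union of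
  them, hence in the sigma-algebra they generate.\<close>

lemma sets_path_borel:
  fixes F :: "'v \<Rightarrow> 'v \<Rightarrow> nat"
  assumes "countable (UNIV :: 'v set)"
  shows "sets (path_borel F) = sigma_sets (path_space F) (insert {} (cylinder F ` finite_paths F))"
    (is "_ = sigma_sets ?X ?G")
proof -
  let ?O = "{U. openin (path_topology F) U}"
  \<comment> \<open>The measure space built by \<open>sigma\<close> has the generated sigma-algebra
    as its \<open>sets\<close> only when the generators are subsets of the space.\<close>
  have "?O \<subseteq> Pow ?X"
  proof (intro subsetI PowI)
    fix U x assume "U \<in> ?O" "x \<in> U"
    then obtain es where "x \<in> cylinder F es"
      using path_topology_base[of F U x] by auto
    then show "x \<in> ?X"
      by (simp add: cylinder_def)
  qed
  then have sets: "sets (path_borel F) = sigma_sets ?X ?O"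
    by (simp add: path_borel_def)
  have "U \<in> sigma_sets ?X ?G" if "openin (path_topology F) U" for U
  proof -
    let ?C = "{C \<in> cylinder F ` finite_paths F. C \<subseteq> U}"
    have "U = \<Union> ?C"
    proof (intro equalityI subsetI)
      fix x assume "x \<in> U"
      from path_topology_base[OF that this] show "x \<in> \<Union> ?C"
        by blast
    qed blast
    moreover have "countable ?C"
      using countable_finite_paths[OF assms] by simp
    then have "\<Union> ?C \<in> sigma_sets ?X ?G"
      by (rule sigma_sets_UNION) auto
    ultimately show ?thesis by simp
  qed
  moreover have "openin (path_topology F) C" if "C \<in> ?G" for C
    using that by (auto simp: path_topology_def intro: topology_generated_by_Basis)
  ultimately show ?thesis
    unfolding sets by (intro sigma_sets_eqI) (simp_all add: sigma_sets.Basic)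
qed

section \<open>The shift on cylinder sets\<close>

lemma zero_one_edges:
  assumes "zero_one F"
  shows "edges F = {(w, v, 0) | w v. F v w \<noteq> 0}"
proof -
  have "k < F v w \<longleftrightarrow> k = 0 \<and> F v w \<noteq> 0" for v w k
    using assms[unfolded zero_one_def, rule_format, of v w] by auto
  then show ?thesis
    unfolding edges_def by blast
qed

lemma Cons_finite_path:
  assumes "es \<in> finite_paths F" "e \<in> edges F" "rng e = src (es ! 0)"
  shows "e # es \<in> finite_paths F"
  using assms by (auto simp: finite_paths_def nth_Cons split: nat.split)

lemma shift_in_path_space: "x \<in> path_space F \<Longrightarrow> shift x \<in> path_space F"
  by (auto simp: path_space_def shift_def)

text \<open>The shift forgets only the first edge of a path. That edge must end where
  \<open>es\<close> starts, and in a 0-1 diagram it is then determined by its source, so the union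
  can run over vertices.\<close>

lemma vimage_shift_cylinder:
  assumes "zero_one F" "es \<noteq> []"
  shows "shift -` cylinder F es \<inter> path_space F =
    (\<Union>w \<in> {w. F (src (es ! 0)) w \<noteq> 0}. cylinder F ((w, src (es ! 0), 0) # es))"
    (is "?L = ?R")
proof (intro equalityI subsetI)
  fix x assume "x \<in> ?L"
  then have x: "x \<in> path_space F" "\<And>i. i < length es \<Longrightarrow> x (Suc i) = es ! i"
    by (auto simp: cylinder_def shift_def)
  then have "x 0 \<in> edges F" "rng (x 0) = src (es ! 0)"
    using assms(2) by (auto simp: path_space_def)
  then obtain w where w: "F (src (es ! 0)) w \<noteq> 0" "x 0 = (w, src (es ! 0), 0)"
    by (auto simp: zero_one_edges[OF assms(1)] rng_def)
  then have "x \<in> cylinder F ((w, src (es ! 0), 0) # es)"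
    using x by (auto simp: cylinder_def nth_Cons split: nat.split)
  then show "x \<in> ?R"
    using w(1) by blast
next
  fix x assume "x \<in> ?R"
  then obtain w where "x \<in> cylinder F ((w, src (es ! 0), 0) # es)"
    by blast
  then have x: "x \<in> path_space F" "\<And>i. i < Suc (length es) \<Longrightarrow> x i = ((w, src (es ! 0), 0) # es) ! i"
    by (auto simp: cylinder_def)
  have "x (Suc i) = es ! i" if "i < length es" for i
    using x(2)[of "Suc i"] that by simp
  then show "x \<in> ?L"
    using x(1) shift_in_path_space[OF x(1)] by (simp add: cylinder_def shift_def)
qed

lemma sets_markov_cylinder:
  fixes F :: "'v \<Rightarrow> 'v \<Rightarrow> nat"
  assumes "countable (UNIV :: 'v set)" "stationary_markov_measure F q P m" "es \<in> finite_paths F"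
  shows "cylinder F es \<in> sets m"
  using assms by (auto simp: stationary_markov_measure_def sets_path_borel)

lemma emeasure_vimage_shift_cylinder:
  fixes F :: "'v \<Rightarrow> 'v \<Rightarrow> nat"
  assumes F: "is_incidence_matrix F" "zero_one F"
    and q: "\<And>v. q v \<ge> 0" and P: "\<And>v w. P v w \<ge> 0"
    and m: "stationary_markov_measure F q P m" and es: "es \<in> finite_paths F"
  shows "emeasure m (shift -` cylinder F es \<inter> space m) =
    ennreal ((\<Sum>w | F (src (es ! 0)) w \<noteq> 0. q w * P w (src (es ! 0))) *
      (\<Prod>i<length es. P (src (es ! i)) (rng (es ! i))))"
proof -
  define v where "v = src (es ! 0)"
  define c where "c = (\<Prod>i<length es. P (src (es ! i)) (rng (es ! i)))"
  let ?W = "{w. F v w \<noteq> 0}" and ?C = "\<lambda>w. cylinder F ((w, v, 0) # es)"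
  have paths: "(w, v, 0) # es \<in> finite_paths F" if "w \<in> ?W" for w
    using es that
    by (intro Cons_finite_path) (auto simp: zero_one_edges[OF F(2)] v_def rng_def)
  \<comment> \<open>For distinct \<open>w\<close> the prescribed edges at position 0 have distinct
    sources.\<close>
  have disj: "disjoint_family_on ?C ?W"
    by (force simp: disjoint_family_on_def cylinder_def)
  \<comment> \<open>The product over the lengthened word splits off its factor at index 0, which is
    \<open>P w v\<close>; the remaining factors are those of \<open>es\<close>, and \<open>q\<close>
    is now evaluated at the new source \<open>w\<close>.\<close>
  have "emeasure m (?C w) = ennreal (q w * P w v * c)" if "w \<in> ?W" for w
    using m paths[OF that]
    by (simp add: stationary_markov_measure_def prod.lessThan_Suc_shift c_def src_def rng_def
        mult.assoc del: prod.lessThan_Suc)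
  moreover have "finite ?W"
    using F(1) by (simp add: is_incidence_matrix_def)
  moreover have "?C ` ?W \<subseteq> sets m"
    using sets_markov_cylinder[OF _ m paths] F(1) by (auto simp: is_incidence_matrix_def)
  ultimately have "emeasure m (\<Union>w\<in>?W. ?C w) = (\<Sum>w\<in>?W. ennreal (q w * P w v * c))"
    using sum_emeasure[OF _ disj] by (metis (no_types, lifting) sum.cong)
  also have "\<dots> = ennreal ((\<Sum>w\<in>?W. q w * P w v) * c)"
    using q P by (simp add: sum_distrib_right c_def prod_nonneg)
  finally show ?thesis
    using vimage_shift_cylinder[OF F(2)] m es
    by (simp add: v_def c_def stationary_markov_measure_def finite_paths_def)
qed

text \<open>Allows the measures of preimages to be read as values of the image measure
  \<open>distr m m shift\<close>. It suffices to test generators, whose preimages are finite unions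
  of cylinders.\<close>

lemma shift_measurable:
  fixes F :: "'v \<Rightarrow> 'v \<Rightarrow> nat"
  assumes F: "is_incidence_matrix F" "zero_one F" and m: "stationary_markov_measure F q P m"
  shows "shift \<in> measurable m m"
proof (rule measurable_sigma_sets)
  have countable: "countable (UNIV :: 'v set)"
    using F(1) by (simp add: is_incidence_matrix_def)
  show "sets m = sigma_sets (path_space F) (insert {} (cylinder F ` finite_paths F))"
    using m sets_path_borel[OF countable] by (simp add: stationary_markov_measure_def)
  show "insert {} (cylinder F ` finite_paths F) \<subseteq> Pow (path_space F)"
    by (auto simp: cylinder_def)
  show "shift \<in> space m \<rightarrow> path_space F"
    using m by (auto simp: stationary_markov_measure_def shift_in_path_space)
  fix C assume "C \<in> insert {} (cylinder F ` finite_paths F)"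
  then consider "C = {}" | es where "es \<in> finite_paths F" "C = cylinder F es"
    by blast
  then show "shift -` C \<inter> space m \<in> sets m"
  proof cases
    case (2 es)
    let ?v = "src (es ! 0)"
    have "(w, ?v, 0) # es \<in> finite_paths F" if "F ?v w \<noteq> 0" for w
      using 2(1) that
      by (intro Cons_finite_path) (auto simp: zero_one_edges[OF F(2)] rng_def)
    then have "cylinder F ((w, ?v, 0) # es) \<in> sets m" if "F ?v w \<noteq> 0" for w
      using sets_markov_cylinder[OF countable m] that by blast
    moreover have "finite {w. F ?v w \<noteq> 0}"
      using F(1) by (simp add: is_incidence_matrix_def)
    ultimately have "(\<Union>w \<in> {w. F ?v w \<noteq> 0}. cylinder F ((w, ?v, 0) # es)) \<in> sets m"
      by (intro sets.finite_UN) auto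
    then show ?thesis
      using vimage_shift_cylinder[OF F(2), of es] 2 m
      by (simp add: stationary_markov_measure_def finite_paths_def)
  qed simp
qed

section \<open>From invariance to the equation for the vector \<open>q\<close>\<close>

lemma shift_invariant_iff_cylinders:
  fixes F :: "'v \<Rightarrow> 'v \<Rightarrow> nat"
  assumes F: "is_incidence_matrix F" "zero_one F" and m: "stationary_markov_measure F q P m"
  shows "shift_invariant m \<longleftrightarrow> (\<forall>es \<in> finite_paths F.
    emeasure m (shift -` cylinder F es \<inter> space m) = emeasure m (cylinder F es))"
proof -
  have countable: "countable (UNIV :: 'v set)"
    using F(1) by (simp add: is_incidence_matrix_def)
  note in_sets = sets_markov_cylinder[OF countable m]
  note meas = shift_measurable[OF F m]
  show ?thesis
  proof
    assume "shift_invariant m"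
    then show "\<forall>es \<in> finite_paths F.
        emeasure m (shift -` cylinder F es \<inter> space m) = emeasure m (cylinder F es)"
      using in_sets by (simp add: shift_invariant_def)
  next
    assume eq: "\<forall>es \<in> finite_paths F.
        emeasure m (shift -` cylinder F es \<inter> space m) = emeasure m (cylinder F es)"
    have sets: "sets m = sigma_sets (path_space F) (insert {} (cylinder F ` finite_paths F))"
      using m sets_path_borel[OF countable] by (simp add: stationary_markov_measure_def)
    \<comment> \<open>Uniqueness of measures on an intersection-stable generator. The countable
      cover by sets of finite measure that it requires consists of all the cylinders, whose
      \<open>m\<close>-values are real numbers.\<close>
    have "distr m m shift = m"
    proof (rule measure_eqI_generator_eq_countable[OF Int_stable_cylinders])
      show "cylinder F ` finite_paths F \<subseteq> insert {} (cylinder F ` finite_paths F)"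
        by blast
      show "countable (cylinder F ` finite_paths F)"
        using countable_finite_paths[OF countable] by simp
      show "emeasure (distr m m shift) C = emeasure m C"
        if "C \<in> insert {} (cylinder F ` finite_paths F)" for C
        using that eq in_sets by (auto simp: emeasure_distr[OF meas])
      show "emeasure (distr m m shift) C \<noteq> \<infinity>" if "C \<in> cylinder F ` finite_paths F" for C
        using that eq in_sets m
        by (auto simp: emeasure_distr[OF meas] stationary_markov_measure_def)
      show "insert {} (cylinder F ` finite_paths F) \<subseteq> Pow (path_space F)"
        by (auto simp: cylinder_def)
      show "\<Union> (cylinder F ` finite_paths F) = path_space F"
        by (rule path_space_eq_Union_cylinders[symmetric])
    qed (simp_all add: sets)
    then show "shift_invariant m"
      unfolding shift_invariant_def by (metis emeasure_distr meas)
  qed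
qed

theorem theorem2p20:
  fixes F :: "'v \<Rightarrow> 'v \<Rightarrow> nat"
    and q :: "'v \<Rightarrow> real"
    and P :: "'v \<Rightarrow> 'v \<Rightarrow> real"
    and m :: "(nat \<Rightarrow> 'v edge) measure"
  assumes "is_incidence_matrix F"
    and "zero_one F"
    and "no_isolated_points F"
    and "no_finite_tail_classes F"
    and "positive_probability_vector q"
    and "markov_matrix F P"
    and "stationary_markov_measure F q P m"
  shows "shift_invariant m \<longleftrightarrow> (\<forall>v. ((\<lambda>w. q w * P w v) has_sum q v) UNIV)"
proof -
  \<comment> \<open>The entry of \<open>qP\<close> at \<open>v\<close>, written as a finite sum over
    the support of row \<open>v\<close> of \<open>F\<close>.\<close>
  define r where "r v = (\<Sum>w | F v w \<noteq> 0. q w * P w v)" for v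
  define c where "c es = (\<Prod>i<length es. P (src (es ! i)) (rng (es ! i)))" for es
  have q_pos: "q v > 0" for v
    using assms(5) by (simp add: positive_probability_vector_def)
  have P_nonneg: "P w v \<ge> 0" for w v
    using assms(6) by (simp add: markov_matrix_def)
  have P_pos: "P w v > 0 \<longleftrightarrow> F v w \<noteq> 0" for w v
    using assms(6) zero_one_edges[OF assms(2)]
    by (auto simp: markov_matrix_def src_def rng_def)
  have has_sum_iff: "((\<lambda>w. q w * P w v) has_sum q v) UNIV \<longleftrightarrow> r v = q v" for v
  proof -
    have "finite {w. F v w \<noteq> 0}"
      using assms(1) by (simp add: is_incidence_matrix_def)
    then have "((\<lambda>w. q w * P w v) has_sum r v) {w. F v w \<noteq> 0}"
      unfolding r_def by (rule has_sum_finite)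
    moreover have "P w v = 0" if "F v w = 0" for w
      using P_nonneg[of w v] P_pos[of w v] that by linarith
    ultimately have "((\<lambda>w. q w * P w v) has_sum r v) UNIV"
      by (subst has_sum_cong_neutral[of "{w. F v w \<noteq> 0}" _ _ "\<lambda>w. q w * P w v"]) auto
    then show ?thesis
      using has_sum_unique by metis
  qed
  \<comment> \<open>Strict positivity allows this common factor to be cancelled when the two
    measures are compared.\<close>
  have c_pos: "c es > 0" if "es \<in> finite_paths F" for es
    unfolding c_def
  proof (intro prod_pos ballI)
    fix i assume "i \<in> {..<length es}"
    then have "es ! i \<in> edges F"
      using that by (auto simp: finite_paths_def)
    then show "P (src (es ! i)) (rng (es ! i)) > 0"
      by (auto simp: P_pos zero_one_edges[OF assms(2)] src_def rng_def)
  qed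
  have "shift_invariant m \<longleftrightarrow> (\<forall>es \<in> finite_paths F. r (src (es ! 0)) = q (src (es ! 0)))"
    unfolding shift_invariant_iff_cylinders[OF assms(1,2,7)]
  proof (rule ball_cong[OF refl])
    fix es assume es: "es \<in> finite_paths F"
    let ?v = "src (es ! 0)"
    have "emeasure m (shift -` cylinder F es \<inter> space m) = ennreal (r ?v * c es)"
      unfolding r_def c_def
      using q_pos P_nonneg assms(1,2,7) es
      by (intro emeasure_vimage_shift_cylinder) (auto intro: less_imp_le)
    moreover have "emeasure m (cylinder F es) = ennreal (q ?v * c es)"
      using assms(7) es by (simp add: stationary_markov_measure_def c_def)
    \<comment> \<open>As \<open>ennreal\<close> sends negative reals to 0, signs are needed to turn
      the equality of measures into one of reals.\<close>
    moreover have "r ?v \<ge> 0"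
      unfolding r_def using less_imp_le[OF q_pos] P_nonneg by (intro sum_nonneg mult_nonneg_nonneg)
    ultimately show "emeasure m (shift -` cylinder F es \<inter> space m) = emeasure m (cylinder F es)
        \<longleftrightarrow> r ?v = q ?v"
      using c_pos[OF es] q_pos[of ?v] by simp
  qed
  also have "\<dots> \<longleftrightarrow> (\<forall>v. r v = q v)"
  proof (intro iffI allI ballI)
    fix v assume r: "\<forall>es \<in> finite_paths F. r (src (es ! 0)) = q (src (es ! 0))"
    \<comment> \<open>Column \<open>v\<close> of \<open>F\<close> is non-zero, so some edge starts
      at \<open>v\<close>. The cylinder of this single edge tests the equation at
      \<open>v\<close>.\<close>
    obtain u where "F u v \<noteq> 0"
      using assms(1) unfolding is_incidence_matrix_def by blast
    then have "[(v, u, 0)] \<in> finite_paths F"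
      by (intro singleton_finite_path) (simp add: zero_one_edges[OF assms(2)])
    then show "r v = q v"
      using r by (force simp: src_def)
  qed simp
  finally show ?thesis
    by (simp add: has_sum_iff)
qed

end
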